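(* Let $f$ and $g$ be transcendental entire functions satisfying $f\circ g=g\circ f$. Then: (1) $I(f)$ and $I(g)$ are backward invariant under $f\circ g$; (2) for $w\in\mathbb{C}$, if $w\notin I(f)$ then $g(w)\notin I(f)$.
   Context: For an entire function $h$, $h^n$ denotes the $n$-th iterate of $h$, and the escaping set of $h$ is $I(h)=\{z\in\mathbb{C}: h^n(z)\to\infty \text{ as } n\to\infty\}$. A set $W\subset\mathbb{C}$ is backward invariant under $h$ if $h^{-1}(W)=\{w\in\mathbb{C}: h(w)\in W\}\subset W$. *)

theory Defs
  imports "HOL-Analysis.Analysis" "HOL-Computational_Algebra.Polynomial"
begin

definition transcendental_entire :: "(complex \<Rightarrow> complex) \<Rightarrow> bool" where
  "transcendental_entire h \<longleftrightarrow> h holomorphic_on UNIV \<and> \<not> (\<exists>p. h = poly p)"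

definition escaping_set :: "(complex \<Rightarrow> complex) \<Rightarrow> complex set" where
  "escaping_set h = {z. filterlim (\<lambda>n. (h ^^ n) z) at_infinity sequentially}"

definition backward_invariant :: "(complex \<Rightarrow> complex) \<Rightarrow> complex set \<Rightarrow> bool" where
  "backward_invariant h W \<longleftrightarrow> h -` W \<subseteq> W"

end

theory Submission
  imports Defs
begin

text \<open>
  Everything rests on one observation. Let \<open>h\<close> be continuous on the plane and commute with \<open>k\<close>.
  Then \<open>k\<^sup>n (h w) = h (k\<^sup>n w)\<close>, and \<open>h\<close> is bounded on every closed disc, so the orbit of
  \<open>h w\<close> under \<open>k\<close> can tend to infinity only if the orbit of \<open>w\<close> leaves every disc for good. Hence
  the escaping set of \<open>k\<close> is backward invariant under \<open>h\<close>
  (\<open>escaping_set_backward_invariant\<close>). If \<open>f\<close> and \<open>g\<close> commute, then \<open>f \<circ> g\<close> commutes with each of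
  them, which gives the first assertion; the second is the contrapositive of backward invariance
  of the escaping set of \<open>f\<close> under \<open>g\<close>.
\<close>

text \<open>
  Closed balls of the domain are compact, so \<open>h\<close> is bounded on each of them: once the values
  exceed that bound in norm, the arguments lie outside the ball.
\<close>

lemma filterlim_at_infinity_of_continuous_image:
  fixes h :: "'a::{real_normed_vector, heine_borel} \<Rightarrow> 'b::real_normed_vector"
  assumes cont: "continuous_on UNIV h"
    and lim: "filterlim (\<lambda>x. h (u x)) at_infinity F"
  shows "filterlim u at_infinity F"
  unfolding filterlim_at_infinity[OF order.refl]
proof (intro allI impI)
  fix r :: real
  have "compact (h ` cball 0 r)"
    by (intro compact_continuous_image continuous_on_subset[OF cont]) auto
  then obtain B where B: "\<And>z. z \<in> cball 0 r \<Longrightarrow> norm (h z) \<le> B"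
    by (metis bounded_iff compact_imp_bounded imageI)
  have "\<forall>\<^sub>F x in F. norm (h (u x)) > B"
    using lim by (simp add: filterlim_at_infinity_conv_norm_at_top filterlim_at_top_dense)
  then show "\<forall>\<^sub>F x in F. r \<le> norm (u x)"
  proof eventually_elim
    case (elim x)
    then have "u x \<notin> cball 0 r" using B[of "u x"] by auto
    then show ?case by simp
  qed
qed

lemma funpow_commute:
  assumes "h \<circ> k = k \<circ> h"
  shows "(k ^^ n) (h w) = h ((k ^^ n) w)"
  using assms by (induction n) (auto simp: fun_eq_iff)

lemma escaping_set_backward_invariant:
  assumes "continuous_on UNIV h" and "h \<circ> k = k \<circ> h"
  shows "backward_invariant h (escaping_set k)"
  unfolding backward_invariant_def
proof
  fix w assume "w \<in> h -` escaping_set k"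
  then have "filterlim (\<lambda>n. h ((k ^^ n) w)) at_infinity sequentially"
    by (simp add: escaping_set_def funpow_commute[OF assms(2)])
  then show "w \<in> escaping_set k"
    using filterlim_at_infinity_of_continuous_image[OF assms(1)]
    by (simp add: escaping_set_def)
qed

lemma transcendental_entire_continuous_on:
  "transcendental_entire h \<Longrightarrow> continuous_on UNIV h"
  by (simp add: transcendental_entire_def holomorphic_on_imp_continuous_on)

theorem theorem2p6:
  fixes f g :: "complex \<Rightarrow> complex"
  assumes "transcendental_entire f"
    and "transcendental_entire g"
    and "f \<circ> g = g \<circ> f"
  shows "(backward_invariant (f \<circ> g) (escaping_set f)
          \<and> backward_invariant (f \<circ> g) (escaping_set g))
      \<and> (\<forall>w. w \<notin> escaping_set f \<longrightarrow> g w \<notin> escaping_set f)"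
proof -
  have cont_f: "continuous_on UNIV f" and cont_g: "continuous_on UNIV g"
    using assms(1,2) by (simp_all add: transcendental_entire_continuous_on)
  have cont_fg: "continuous_on UNIV (f \<circ> g)"
    by (rule continuous_on_compose[OF cont_g continuous_on_subset[OF cont_f]]) simp
  have "(f \<circ> g) \<circ> f = f \<circ> (f \<circ> g)" and "(f \<circ> g) \<circ> g = g \<circ> (f \<circ> g)"
    using assms(3) by (simp_all add: fun_eq_iff)
  then have "backward_invariant (f \<circ> g) (escaping_set f)"
    and "backward_invariant (f \<circ> g) (escaping_set g)"
    using escaping_set_backward_invariant[OF cont_fg] by blast+
  moreover have "backward_invariant g (escaping_set f)"
    by (rule escaping_set_backward_invariant[OF cont_g assms(3)[symmetric]])
  ultimately show ?thesis
    by (auto simp: backward_invariant_def)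
qed

end
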